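(* Let ${\bf n}'=n'_1n'_2n'_3\cdots$ be the fixed point of $0\mapsto01$, $1\mapsto2$, $2\mapsto0$ starting with $0$, indexed from $1$ (so ${\bf n}'=0120010120120\cdots$). For $i\in\{0,1,2\}$ and $j\ge1$ let $p_i(j)$ be the position of the $j$-th occurrence of the letter $i$ in ${\bf n}'$, and let $p_{02}(j)$ be the position of the $j$-th occurrence of a letter from $\{0,2\}$ in ${\bf n}'$. Then for all $j\ge1$: $p_{02}(j)=[(j-1)_N0]_N+1$; $p_0(j)=[(j-1)_N00]_N+1$; $p_1(j)=[(j-1)_N000]_N+2=p_0(j)+j$; $p_2(j)=[(j-1)_N0000]_N+3=p_1(j)+p_{02}(j)$.
   Context: Narayana numbers: $N_0=1,N_1=2,N_2=3$, $N_i=N_{i-1}+N_{i-3}$ for $i\ge3$. Every nonnegative integer $m$ has a unique Narayana representation $(m)_N=e_1\cdots e_t$ (binary word, $e_1=1$ if $t\ge1$, no factor $11$ or $101$, $m=\sum_{i=1}^te_iN_{t-i}$; $(0)_N$ is empty). For a binary word $w=e_1\cdots e_t$, $[w]_N=\sum_{i=1}^t e_iN_{t-i}$. *)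

theory Defs
  imports "HOL-Library.Stream" "HOL-Library.Sublist" "HOL-Library.Infinite_Set"
begin

subsection \<open>Narayana numbers and Narayana representations\<close>

fun narayana :: "nat \<Rightarrow> nat" where
  "narayana 0 = 1"
| "narayana (Suc 0) = 2"
| "narayana (Suc (Suc 0)) = 3"
| "narayana (Suc (Suc (Suc i))) = narayana (Suc (Suc i)) + narayana i"

text \<open>Binary words are lists over \<open>{0, 1} :: nat set\<close>, most significant digit first; the digit
  \<open>e\<^sub>i\<close> is \<open>w ! (i - 1)\<close>.\<close>

definition narayana_val :: "nat list \<Rightarrow> nat" where
  "narayana_val w = (\<Sum>i = 1..length w. w ! (i - 1) * narayana (length w - i))"

text \<open>\<open>sublist\<close> is the contiguous one, i.e. the factor relation on words.\<close>

definition is_narayana_rep :: "nat \<Rightarrow> nat list \<Rightarrow> bool" where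
  "is_narayana_rep m w \<longleftrightarrow>
     set w \<subseteq> {0, 1} \<and> (w \<noteq> [] \<longrightarrow> hd w = 1) \<and>
     \<not> sublist [1, 1] w \<and> \<not> sublist [1, 0, 1] w \<and>
     m = narayana_val w"

text \<open>Well defined by \<open>ex1_narayana_rep\<close> below.\<close>

definition narayana_rep :: "nat \<Rightarrow> nat list" where
  "narayana_rep m = (THE w. is_narayana_rep m w)"

subsection \<open>The infinite word\<close>

datatype letter = L0 | L1 | L2

fun morph :: "letter \<Rightarrow> letter list" where
  "morph L0 = [L0, L1]"
| "morph L1 = [L2]"
| "morph L2 = [L0]"

text \<open>\<open>flat (smap morph s)\<close> is the image of the infinite word \<open>s\<close> under the morphism.
  The fixed point exists and is unique by \<open>ex1_fixed_point\<close> below.\<close>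

definition is_fixed_point :: "letter stream \<Rightarrow> bool" where
  "is_fixed_point s \<longleftrightarrow> flat (smap morph s) = s \<and> shd s = L0"

definition n_word :: "letter stream" where
  "n_word = (THE s. is_fixed_point s)"

text \<open>Streams are indexed from 0, the word from 1; only \<open>k \<ge> 1\<close> is meaningful.\<close>

definition nprime :: "nat \<Rightarrow> letter" where
  "nprime k = n_word !! (k - 1)"

text \<open>The position of the \<open>j\<close>-th occurrence (\<open>j \<ge> 1\<close>) of a letter from \<open>A\<close>;
  \<open>enumerate S\<close> lists an infinite set \<open>S\<close> in increasing order, starting with index 0.\<close>

definition pos :: "letter set \<Rightarrow> nat \<Rightarrow> nat" where
  "pos A j = enumerate {k. 1 \<le> k \<and> nprime k \<in> A} (j - 1)"

abbreviation p0 :: "nat \<Rightarrow> nat" where "p0 \<equiv> pos {L0}"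
abbreviation p1 :: "nat \<Rightarrow> nat" where "p1 \<equiv> pos {L1}"
abbreviation p2 :: "nat \<Rightarrow> nat" where "p2 \<equiv> pos {L2}"
abbreviation p02 :: "nat \<Rightarrow> nat" where "p02 \<equiv> pos {L0, L2}"

subsection \<open>The definitions above are meaningful\<close>

lemma morph_nonempty [simp]: "morph a \<noteq> []"
  by (cases a) auto

lemma flat_smap_shift: "flat (smap morph (xs @- s)) = concat (map morph xs) @- flat (smap morph s)"
  by (induction xs) auto

lemma length_le_concat_morph: "length xs \<le> length (concat (map morph xs))"
proof (induction xs)
  case (Cons a xs)
  then show ?case by (cases a) auto
qed simp

lemma concat_map_morph_nonempty: "xs \<noteq> [] \<Longrightarrow> concat (map morph xs) \<noteq> []"
  by (cases xs) auto

lemma stream_eqI_stake: "(\<And>n. stake n s = stake n t) \<Longrightarrow> s = t"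
  by (metis lessI stake_nth smap_alt stream.map_ident)

lemma flat_smap_flat:
  assumes "\<And>xs. xs \<in> sset ws \<Longrightarrow> xs \<noteq> []"
  shows "flat (smap morph (flat ws)) = flat (smap (\<lambda>xs. concat (map morph xs)) ws)"
proof (rule stream_eqI_stake)
  fix n
  show "stake n (flat (smap morph (flat ws))) =
      stake n (flat (smap (\<lambda>xs. concat (map morph xs)) ws))"
    using assms
  proof (induction n arbitrary: ws rule: less_induct)
    case (less n)
    obtain xs ws' where ws: "ws = xs ## ws'" by (cases ws)
    have xs: "xs \<noteq> []" and ws': "\<And>ys. ys \<in> sset ws' \<Longrightarrow> ys \<noteq> []"
      using less.prems by (auto simp: ws)
    define c where "c = concat (map morph xs)"
    have c: "c \<noteq> []" using concat_map_morph_nonempty[OF xs] by (simp add: c_def)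
    have l: "flat (smap morph (flat ws)) = c @- flat (smap morph (flat ws'))"
      using xs by (simp add: ws flat_smap_shift c_def del: smap_shift)
    have r: "flat (smap (\<lambda>xs. concat (map morph xs)) ws)
        = c @- flat (smap (\<lambda>xs. concat (map morph xs)) ws')"
      using c unfolding ws c_def stream.map stream.sel by (rule flat_Stream)
    show ?case
    proof (cases "n = 0")
      case False
      then have "n - length c < n" using c by simp
      from less.IH[OF this ws'] show ?thesis by (simp add: l r stake_shift)
    qed simp
  qed
qed

lemma ex_fixed_point: "\<exists>s. is_fixed_point s"
proof -
  define H where "H = (\<lambda>xs. concat (map morph xs))"
  define s where "s = L0 ## flat (siterate H [L1])"
  have ne: "(H ^^ n) [L1] \<noteq> []" for n
    by (induction n) (auto simp: H_def concat_map_morph_nonempty)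
  have "flat (smap morph s) = L0 ## L1 ## flat (smap morph (flat (siterate H [L1])))"
    by (simp add: s_def)
  also have "flat (smap morph (flat (siterate H [L1]))) = flat (smap H (siterate H [L1]))"
    unfolding H_def by (rule flat_smap_flat) (use ne in \<open>auto simp: sset_siterate H_def\<close>)
  also have "\<dots> = flat (siterate H (H [L1]))"
    by (simp only: smap_siterate)
  also have "L1 ## flat (siterate H (H [L1])) = flat (siterate H [L1])"
    by (subst (2) siterate.code) simp
  finally have "flat (smap morph s) = s" by (simp add: s_def)
  moreover have "shd s = L0" by (simp add: s_def)
  ultimately show ?thesis unfolding is_fixed_point_def by blast
qed

lemma fixed_point_unfold:
  assumes "is_fixed_point s"
  shows "s = L0 ## L1 ## flat (smap morph (stl s))"
proof -
  obtain t where "s = L0 ## t"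
    using assms by (cases s) (auto simp: is_fixed_point_def)
  then show ?thesis
    using assms by (simp add: is_fixed_point_def)
qed

lemma stake_flat_cong:
  assumes "stake n s = stake n t"
  shows "stake n (flat (smap morph s)) = stake n (flat (smap morph t))"
proof -
  have "flat (smap morph u) = concat (map morph (stake n u)) @- flat (smap morph (sdrop n u))" for u
    by (metis flat_smap_shift stake_sdrop)
  moreover have "n \<le> length (concat (map morph (stake n u)))" for u
    using length_le_concat_morph[of "stake n u"] by simp
  ultimately have "stake n (flat (smap morph u)) = take n (concat (map morph (stake n u)))" for u
    by (metis append_Nil2 diff_is_0_eq stake.simps(1) stake_shift)
  then show ?thesis using assms by simp
qed

lemma ex1_fixed_point: "\<exists>!s. is_fixed_point s"
proof (rule ex_ex1I[OF ex_fixed_point])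
  fix s t assume s: "is_fixed_point s" and t: "is_fixed_point t"
  have "stake n (stl s) = stake n (stl t)" for n
  proof (induction n)
    case (Suc n)
    have "stl s = L1 ## flat (smap morph (stl s))" "stl t = L1 ## flat (smap morph (stl t))"
      using fixed_point_unfold[OF s] fixed_point_unfold[OF t] by (metis stream.sel(2))+
    then show ?case
      using stake_flat_cong[OF Suc] by (metis stake.simps(2) stream.sel)
  qed simp
  then have "stl s = stl t" by (rule stream_eqI_stake)
  then show "s = t" using fixed_point_unfold[OF s] fixed_point_unfold[OF t] by metis
qed

lemma n_word_fixed_point: "flat (smap morph n_word) = n_word" "shd n_word = L0"
  using theI'[OF ex1_fixed_point] by (auto simp: n_word_def is_fixed_point_def)

lemma narayana_val_Nil [simp]: "narayana_val [] = 0"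
  by (simp add: narayana_val_def)

lemma narayana_val_Cons [simp]:
  "narayana_val (x # w) = x * narayana (length w) + narayana_val w"
proof -
  have "narayana_val (x # w) =
      (\<Sum>i = 0..length w. (x # w) ! i * narayana (length w - i))"
    unfolding narayana_val_def
    by (rule sum.reindex_bij_witness[of _ Suc "\<lambda>i. i - 1"]) auto
  also have "\<dots> = x * narayana (length w) +
      (\<Sum>i = 1..length w. (x # w) ! i * narayana (length w - i))"
    by (subst sum.atLeast_Suc_atMost) auto
  also have "(\<Sum>i = 1..length w. (x # w) ! i * narayana (length w - i)) = narayana_val w"
    unfolding narayana_val_def by (rule sum.cong) (auto simp: nth_Cons')
  finally show ?thesis .
qed

definition adm :: "nat list \<Rightarrow> bool" where
  "adm w \<longleftrightarrow> set w \<subseteq> {0, 1} \<and> \<not> sublist [1, 1] w \<and> \<not> sublist [1, 0, 1] w"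

lemma adm_Nil [simp]: "adm []"
  by (simp add: adm_def)

lemma adm_0 [simp]: "adm (0 # w) \<longleftrightarrow> adm w"
  by (auto simp: adm_def sublist_Cons_right)

lemma adm_1:
  "adm (Suc 0 # w) \<longleftrightarrow> w = [] \<or> w = [0] \<or> (\<exists>v. w = 0 # 0 # v \<and> adm v)"
proof (cases w)
  case (Cons a u)
  then show ?thesis
    by (cases u) (auto simp: adm_def sublist_Cons_right)
qed (simp add: adm_def sublist_Cons_right)

lemma adm_digit: "adm (x # w) \<Longrightarrow> x = 0 \<or> x = Suc 0"
  by (auto simp: adm_def)

lemma narayana_mono_Suc: "narayana n < narayana (Suc n)"
  by (induction n rule: narayana.induct) auto

lemma narayana_mono: "m \<le> n \<Longrightarrow> narayana m \<le> narayana n"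
  using narayana_mono_Suc by (metis lift_Suc_mono_le less_imp_le)

lemma narayana_val_less: "adm w \<Longrightarrow> narayana_val w < narayana (length w)"
proof (induction w rule: length_induct)
  case (1 w)
  show ?case
  proof (cases w)
    case (Cons x u)
    then consider "x = 0" "adm u" | "x = Suc 0" "u = []" | "x = Suc 0" "u = [0]"
      | v where "x = Suc 0" "u = 0 # 0 # v" "adm v"
      using 1(2) adm_digit[of x u] by (auto simp: adm_1)
    then show ?thesis
    proof cases
      case 1
      then have "narayana_val u < narayana (length u)" using "1.IH" Cons by simp
      with 1 show ?thesis using narayana_mono_Suc[of "length u"] by (simp add: Cons)
    next
      case (4 v)
      then have "narayana_val v < narayana (length v)" using "1.IH" Cons by simp
      with 4 show ?thesis by (simp add: Cons)
    qed (auto simp: Cons)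
  qed simp
qed

lemma ex_adm: "m < narayana n \<Longrightarrow> \<exists>w. adm w \<and> length w = n \<and> narayana_val w = m"
proof (induction n arbitrary: m rule: less_induct)
  case (less n)
  show ?case
  proof (cases n)
    case 0
    with less.prems show ?thesis by simp
  next
    case (Suc k)
    show ?thesis
    proof (cases "m < narayana k")
      case True
      then obtain w where "adm w \<and> length w = k \<and> narayana_val w = m"
        using less.IH Suc by blast
      then show ?thesis by (intro exI[of _ "0 # w"]) (simp add: Suc)
    next
      case False
      consider "k = 0" | "k = 1" | i where "k = Suc (Suc i)"
        by (metis One_nat_def not0_implies_Suc)
      then show ?thesis
      proof cases
        case 1
        then show ?thesis using False less.prems Suc
          by (intro exI[of _ "[1]"]) (auto simp: adm_1)
      next
        case 2
        then show ?thesis using False less.prems Suc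
          by (intro exI[of _ "[1, 0]"]) (auto simp: adm_1)
      next
        case (3 i)
        then have "m - narayana k < narayana i" using False less.prems Suc by auto
        then obtain v where "adm v \<and> length v = i \<and> narayana_val v = m - narayana k"
          using less.IH[of i] Suc 3 by auto
        then show ?thesis using False
          by (intro exI[of _ "1 # 0 # 0 # v"]) (auto simp: adm_1 Suc 3)
      qed
    qed
  qed
qed

lemma adm_inj:
  assumes "adm v" "adm w" "length v = length w" "narayana_val v = narayana_val w"
  shows "v = w"
  using assms(3,1,2,4)
proof (induction v w rule: list_induct2)
  case (Cons x v y w)
  have sub: "adm u" if "adm (z # u)" for z u
    using that by (auto simp: adm_def sublist_Cons_right)
  have "narayana_val v < narayana (length v)" "narayana_val w < narayana (length w)"
    using Cons.prems sub narayana_val_less by blast+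
  then have "x = y"
    using Cons adm_digit[of x v] adm_digit[of y w] by auto
  then show ?case using Cons sub by auto
qed simp

lemma ex1_narayana_rep: "\<exists>!w. is_narayana_rep m w"
proof -
  have rep: "is_narayana_rep m w \<longleftrightarrow> adm w \<and> (w \<noteq> [] \<longrightarrow> hd w = 1) \<and> m = narayana_val w" for w
    by (auto simp: is_narayana_rep_def adm_def)
  have strip: "\<exists>u. adm u \<and> (u \<noteq> [] \<longrightarrow> hd u = 1) \<and> narayana_val u = narayana_val w" if "adm w" for w
    using that
  proof (induction w)
    case (Cons x w)
    show ?case
    proof (cases "x = 0")
      case True
      with Cons show ?thesis by simp
    next
      case False
      with adm_digit[OF Cons.prems] show ?thesis
        by (intro exI[of _ "x # w"]) (use Cons.prems in auto)
    qed
  qed (auto intro: exI[of _ "[]"])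
  have "m < narayana m"
  proof (induction m)
    case (Suc m)
    then show ?case using narayana_mono_Suc[of m] by linarith
  qed simp
  then obtain w where "adm w" "narayana_val w = m" using ex_adm by blast
  then have ex: "\<exists>u. is_narayana_rep m u" using strip rep by metis
  have len: "length v \<le> length w" if rv: "is_narayana_rep m v" and rw: "is_narayana_rep m w" for v w
  proof (rule ccontr)
    assume less: "\<not> length v \<le> length w"
    then obtain v' where v: "v = 1 # v'" "length w \<le> length v'"
      using rv by (cases v) (auto simp: rep)
    have "m < narayana (length w)" using rw narayana_val_less by (auto simp: rep)
    also have "\<dots> \<le> narayana (length v')" using v by (simp add: narayana_mono)
    also have "\<dots> \<le> m" using rv v by (auto simp: rep)
    finally show False by simp
  qed
  show ?thesis
  proof (rule ex_ex1I[OF ex])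
    fix v w assume *: "is_narayana_rep m v" "is_narayana_rep m w"
    then have "length v = length w" using len by (meson le_antisym)
    then show "v = w" using * adm_inj rep by metis
  qed
qed

end

theory Submission
  imports Defs
begin

text \<open>Read from index 0, the prefixes of the word of Narayana length satisfy the concatenation
  recurrence of the Narayana numbers, so dropping a leading digit 1 from the representation of an
  index does not change the letter there: the letter is 0, 1 or 2 according as the representation,
  padded with leading zeros, ends in 00, 001 or 0010.  Appending zeros to a representation is
  strictly increasing in the represented number, so the indices with a given ending are enumerated
  in increasing order by the prefix in front of that ending.\<close>

subsection \<open>Prefixes of the word\<close>

definition iter_word :: "nat \<Rightarrow> letter list" where
  "iter_word n = ((\<lambda>xs. concat (map morph xs)) ^^ n) [L0]"

text \<open>The base case is the identity 0120 = 012 followed by 0; the morphism applied to both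
  sides gives each further step.\<close>

lemma iter_word_rec:
  "iter_word (Suc (Suc (Suc n))) = iter_word (Suc (Suc n)) @ iter_word n"
  by (induction n) (simp_all add: iter_word_def)

lemma length_iter_word: "length (iter_word n) = narayana n"
proof (induction n rule: narayana.induct)
  case (4 n)
  then show ?case by (simp add: iter_word_rec)
qed (simp_all add: iter_word_def)

lemma n_word_prefix: "\<exists>s. n_word = iter_word n @- s"
proof (induction n)
  case 0
  show ?case
    using n_word_fixed_point(2)
    by (intro exI[of _ "stl n_word"]) (simp add: iter_word_def stream.expand)
next
  case (Suc n)
  then obtain s where "n_word = iter_word n @- s" ..
  then have "n_word = concat (map morph (iter_word n)) @- flat (smap morph s)"
    by (metis flat_smap_shift n_word_fixed_point(1))
  then show ?case by (auto simp: iter_word_def)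
qed

lemma n_word_nth: "i < narayana n \<Longrightarrow> n_word !! i = iter_word n ! i"
  using n_word_prefix[of n] by (metis length_iter_word shift_snth_less)

text \<open>The index falls into the second block of \<open>iter_word_rec\<close>. The number added
  is the weight of the leading 1 in a word 100v with v of length n.\<close>

lemma n_word_narayana_add:
  assumes "i < narayana n"
  shows "n_word !! (narayana (Suc (Suc n)) + i) = n_word !! i"
proof -
  have "n_word !! (narayana (Suc (Suc n)) + i) = iter_word n ! i"
    using assms n_word_nth[of "narayana (Suc (Suc n)) + i" "Suc (Suc (Suc n))"]
    by (simp add: iter_word_rec nth_append length_iter_word)
  then show ?thesis using n_word_nth[OF assms] by simp
qed

subsection \<open>Admissible words\<close>

text \<open>Both forbidden factors are palindromes, so facts about leading digits carry over to
  trailing ones.\<close>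

lemma adm_rev [simp]: "adm (rev w) = adm w"
proof -
  have "sublist [1, 1] (rev w) = sublist [1, 1] w" "sublist [1, 0, 1] (rev w) = sublist [1, 0, 1] w"
    by (simp_all add: sublist_rev_right)
  then show ?thesis by (simp add: adm_def)
qed

lemma adm_snoc_0 [simp]: "adm (w @ [0]) = adm w"
  using adm_rev[of "w @ [0]"] adm_rev[of w] by simp

lemma adm_zeros_append [simp]: "adm (replicate c 0 @ w) = adm w"
  by (induction c) auto

lemma adm_append_zeros [simp]: "adm (w @ replicate c 0) = adm w"
  using adm_rev[of "w @ replicate c 0"] by simp

lemma narayana_val_zeros_append [simp]: "narayana_val (replicate c 0 @ w) = narayana_val w"
  by (induction c) auto

lemma narayana_val_snoc: "narayana_val (w @ [x]) = narayana_val (w @ [0]) + x"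
  by (induction w) auto

lemma narayana_val_append_10:
  "narayana_val (w @ [Suc 0, 0]) = narayana_val (w @ [0, 0]) + 2"
  by (induction w) auto

text \<open>This is the Narayana recurrence applied to the weight of each digit; it yields both
  additive identities between positions.\<close>

lemma narayana_val_append_000:
  "narayana_val (w @ [0, 0, 0]) = narayana_val (w @ [0, 0]) + narayana_val w"
  by (induction w) (auto simp: algebra_simps)

lemma adm_snoc_1:
  "adm (w @ [Suc 0]) \<longleftrightarrow> w = [] \<or> w = [0] \<or> (\<exists>v. w = v @ [0, 0] \<and> adm v)"
proof -
  have "adm (w @ [Suc 0]) \<longleftrightarrow> adm (Suc 0 # rev w)"
    using adm_rev[of "w @ [Suc 0]"] by simp
  also have "\<dots> \<longleftrightarrow> w = [] \<or> w = [0] \<or> (\<exists>v. rev w = 0 # 0 # v \<and> adm v)"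
    by (simp add: adm_1 rev_swap)
  also have "(\<exists>v. rev w = 0 # 0 # v \<and> adm v) \<longleftrightarrow> (\<exists>v. w = v @ [0, 0] \<and> adm v)"
    by (metis adm_rev append.assoc append_Cons append_Nil rev.simps(2) rev_rev_ident)
  finally show ?thesis .
qed

lemma adm_append_001:
  assumes "adm (w @ [Suc 0])"
  shows "\<exists>u. adm u \<and> [0, 0] @ w @ [Suc 0] = u @ [0, 0, Suc 0]"
proof -
  consider "w = []" | "w = [0]" | v where "w = v @ [0, 0]" "adm v"
    using assms by (auto simp: adm_snoc_1)
  then show ?thesis
  proof cases
    case 1
    then show ?thesis by (intro exI[of _ "[]"]) simp
  next
    case 2
    then show ?thesis by (intro exI[of _ "[0]"]) simp
  next
    case (3 v)
    then show ?thesis by (intro exI[of _ "[0, 0] @ v"]) simp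
  qed
qed

text \<open>A 1 in an admissible word has two zeros before it unless it stands among the first two
  digits; the padding supplies what is missing there. It also covers words with fewer than two
  digits.\<close>

lemma adm_ending:
  assumes "adm w"
  shows "\<exists>u. adm u \<and> (replicate 2 0 @ w = u @ [0, 0] \<or>
    replicate 2 0 @ w = u @ [0, 0, Suc 0] \<or> replicate 2 0 @ w = u @ [0, 0, Suc 0, 0])"
proof (cases w rule: rev_cases)
  case Nil
  then show ?thesis by (intro exI[of _ "[]"]) (simp add: numeral_2_eq_2)
next
  case (snoc v x)
  have dig: "set w \<subseteq> {0, Suc 0}" using assms by (simp add: adm_def)
  consider "x = Suc 0" | "x = 0" "v = []" | y t where "x = 0" "v = t @ [y]"
    using dig snoc by (cases v rule: rev_cases) auto
  then show ?thesis
  proof cases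
    case 1
    with snoc assms adm_append_001[of v] show ?thesis by (auto simp: numeral_2_eq_2)
  next
    case 2
    with snoc show ?thesis by (intro exI[of _ "[0]"]) (simp add: numeral_2_eq_2)
  next
    case (3 y t)
    have v: "adm v" using assms adm_snoc_0[of v] by (simp only: snoc 3(1))
    consider "y = 0" | "y = Suc 0" using dig snoc 3 by auto
    then show ?thesis
    proof cases
      case 1
      with v 3 snoc show ?thesis
        by (intro exI[of _ "[0, 0] @ t"]) (simp add: numeral_2_eq_2)
    next
      case 2
      with v 3 obtain u where "adm u" "[0, 0] @ t @ [Suc 0] = u @ [0, 0, Suc 0]"
        using adm_append_001[of t] by auto
      with 2 3 snoc have "replicate 2 0 @ w = u @ [0, 0, Suc 0, 0]"
        by (simp add: numeral_2_eq_2)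
      with \<open>adm u\<close> show ?thesis by blast
    qed
  qed
qed

text \<open>With two zeros in between, a 1 of \<open>u\<close> and a 1 of \<open>z\<close> are at
  distance at least three, so no forbidden factor arises across the border.\<close>

lemma adm_append_00:
  assumes "adm u" "adm z"
  shows "adm (u @ 0 # 0 # z)"
  using assms(1)
proof (induction u rule: length_induct)
  case (1 u)
  show ?case
  proof (cases u)
    case (Cons x v)
    then consider "x = 0" "adm v" | "x = Suc 0" "v = []" | "x = Suc 0" "v = [0]"
      | t where "x = Suc 0" "v = 0 # 0 # t" "adm t"
      using 1(2) adm_digit[of x v] by (auto simp: adm_1)
    then show ?thesis
      using "1.IH" assms(2) Cons by cases (auto simp: adm_1)
  qed (simp add: assms(2))
qed

text \<open>The leading digits of \<open>u\<close> are removed one by one: a 0 does not change the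
  value, and a 1 is followed by 00 and an admissible word, so \<open>n_word_narayana_add\<close>
  applies.\<close>

lemma n_word_val_append:
  assumes "adm u" "adm z"
  shows "n_word !! narayana_val (u @ 0 # 0 # z) = n_word !! narayana_val z"
  using assms(1)
proof (induction u rule: length_induct)
  case (1 u)
  show ?case
  proof (cases u)
    case (Cons x v)
    then consider "x = 0" "adm v" | "x = Suc 0" "v = []" | "x = Suc 0" "v = [0]"
      | t where "x = Suc 0" "v = 0 # 0 # t" "adm t"
      using 1(2) adm_digit[of x v] by (auto simp: adm_1)
    then show ?thesis
    proof cases
      case 1
      then show ?thesis using "1.IH" Cons by simp
    next
      case 2
      then show ?thesis
        using n_word_narayana_add[OF narayana_val_less, OF assms(2)] Cons by simp
    next
      case 3
      \<comment> \<open>The whole word is 1000z, so the tail behind the block 100 is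
        \<open>0 # z\<close>.\<close>
      then show ?thesis
        using n_word_narayana_add[OF narayana_val_less, of "0 # z"] assms(2) Cons by simp
    next
      case (4 t)
      have "adm (t @ 0 # 0 # z)" using 4(3) assms(2) by (rule adm_append_00)
      then have "n_word !! narayana_val (u @ 0 # 0 # z) = n_word !! narayana_val (t @ 0 # 0 # z)"
        using n_word_narayana_add[OF narayana_val_less, of "t @ 0 # 0 # z"] Cons 4 by simp
      also have "\<dots> = n_word !! narayana_val z" using "1.IH" Cons 4 by simp
      finally show ?thesis .
    qed
  qed simp
qed

lemma n_word_initial: "n_word !! 0 = L0" "n_word !! Suc 0 = L1" "n_word !! 2 = L2"
  using n_word_nth[of 0 2] n_word_nth[of 1 2] n_word_nth[of 2 2]
  by (simp_all add: iter_word_def numeral_2_eq_2)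

subsection \<open>Appending zeros to a representation\<close>

text \<open>The four bracketed values in the theorem are this function at \<open>j - 1\<close> with
  c = 1, 2, 3, 4. As a map on numbers it can be composed and tested for monotonicity.\<close>

definition nshift :: "nat \<Rightarrow> nat \<Rightarrow> nat" where
  "nshift c m = narayana_val (narayana_rep m @ replicate c 0)"

lemma narayana_rep_adm: "adm (narayana_rep m)"
  and narayana_val_rep: "narayana_val (narayana_rep m) = m"
proof -
  have "is_narayana_rep m (narayana_rep m)"
    unfolding narayana_rep_def by (rule theI'[OF ex1_narayana_rep])
  then show "adm (narayana_rep m)" "narayana_val (narayana_rep m) = m"
    by (simp_all add: is_narayana_rep_def adm_def)
qed

text \<open>Values of admissible words of equal length are ordered lexicographically: by
  \<open>narayana_val_less\<close> a tail never reaches the weight of the digit before it. Appended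
  zeros keep this order.\<close>

lemma narayana_val_append_zeros_less:
  assumes "length v = length w" "adm v" "adm w" "narayana_val v < narayana_val w"
  shows "narayana_val (v @ replicate c 0) < narayana_val (w @ replicate c 0)"
  using assms
proof (induction v w rule: list_induct2)
  case (Cons x v y w)
  have sub: "adm u" if "adm (z # u)" for z u
    using that by (auto simp: adm_def sublist_Cons_right)
  have v: "adm v" and w: "adm w" using Cons.prems sub by blast+
  have less: "narayana_val v < narayana (length v)" "narayana_val w < narayana (length w)"
    "narayana_val (v @ replicate c 0) < narayana (length v + c)"
    using narayana_val_less[OF v] narayana_val_less[OF w]
      narayana_val_less[of "v @ replicate c 0"] v by auto
  show ?case
    using Cons v w less adm_digit[of x v] adm_digit[of y w] by auto
qed simp

lemma pad_to_equal_length: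
  fixes v w :: "nat list"
  obtains a b where "length (replicate a 0 @ v) = length (replicate b 0 @ w)"
  by (metis add.commute length_append length_replicate)

text \<open>Any admissible word for a number may replace its representation: padded to equal length,
  the two coincide by \<open>adm_inj\<close>.\<close>

lemma nshift_val:
  assumes "adm u"
  shows "nshift c (narayana_val u) = narayana_val (u @ replicate c 0)"
proof -
  let ?v = "narayana_rep (narayana_val u)"
  obtain a b where "length (replicate a 0 @ ?v) = length (replicate b 0 @ u)"
    by (rule pad_to_equal_length)
  then have "replicate a 0 @ ?v = replicate b 0 @ u"
    using assms by (intro adm_inj) (simp_all add: narayana_rep_adm narayana_val_rep)
  then show ?thesis
    by (metis append.assoc narayana_val_zeros_append nshift_def)
qed

lemma strict_mono_nshift: "strict_mono (nshift c)"
proof (rule strict_monoI)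
  fix k m :: nat
  assume "k < m"
  obtain a b where "length (replicate a 0 @ narayana_rep k) = length (replicate b 0 @ narayana_rep m)"
    by (rule pad_to_equal_length)
  then have "narayana_val ((replicate a 0 @ narayana_rep k) @ replicate c 0)
      < narayana_val ((replicate b 0 @ narayana_rep m) @ replicate c 0)"
    using \<open>k < m\<close>
    by (intro narayana_val_append_zeros_less) (simp_all add: narayana_rep_adm narayana_val_rep)
  then show "nshift c k < nshift c m" by (simp add: nshift_def)
qed

lemma nshift_nshift: "nshift c (nshift d m) = nshift (d + c) m"
  by (simp add: nshift_def[of d] nshift_val narayana_rep_adm)
    (simp add: nshift_def replicate_add)

text \<open>Appending 0 turns the ending 001 into 0010, so indices of the letter 1 go to indices of
  the letter 2.\<close>

lemma nshift_Suc_shifted: "nshift 1 (nshift 3 m + 1) = nshift 4 m + 2"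
proof -
  let ?w = "narayana_rep m @ [0, 0]"
  have adm: "adm (?w @ [1])"
    using adm_append_00[OF narayana_rep_adm, of "[1]" m] by (simp add: adm_1)
  have "nshift 3 m + 1 = narayana_val (?w @ [1])"
    using narayana_val_snoc[of ?w 1] by (simp add: nshift_def numeral_3_eq_3)
  then have "nshift 1 (nshift 3 m + 1) = narayana_val ((?w @ [1]) @ replicate 1 0)"
    using nshift_val[OF adm] by metis
  also have "\<dots> = nshift 4 m + 2"
    using narayana_val_append_10[of ?w] by (simp add: nshift_def eval_nat_numeral)
  finally show ?thesis .
qed

section \<open>Letters classified by the ending of the index\<close>

text \<open>What follows the separating 00 is empty, 1 or 10, with value 0, 1 or 2, and the word
  begins with 012.\<close>

lemma n_word_nshift:
  "n_word !! nshift 2 m = L0" "n_word !! (nshift 3 m + 1) = L1" "n_word !! (nshift 4 m + 2) = L2"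
proof -
  let ?u = "narayana_rep m"
  have u: "adm ?u" by (rule narayana_rep_adm)
  have "narayana_val (?u @ [0, 0, 1]) = nshift 3 m + 1"
    using narayana_val_snoc[of "?u @ [0, 0]" 1] by (simp add: nshift_def numeral_3_eq_3)
  moreover have "narayana_val (?u @ [0, 0, 1, 0]) = nshift 4 m + 2"
    using narayana_val_append_10[of "?u @ [0, 0]"] by (simp add: nshift_def eval_nat_numeral)
  moreover have "narayana_val (?u @ [0, 0]) = nshift 2 m"
    by (simp add: nshift_def numeral_2_eq_2)
  moreover have "n_word !! narayana_val (?u @ [0, 0]) = L0"
    using n_word_val_append[OF u, of "[]"] n_word_initial by simp
  moreover have "n_word !! narayana_val (?u @ [0, 0, 1]) = L1"
    using n_word_val_append[OF u, of "[1]"] n_word_initial by (simp add: adm_1)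
  moreover have "n_word !! narayana_val (?u @ [0, 0, 1, 0]) = L2"
    using n_word_val_append[OF u, of "[1, 0]"] n_word_initial(3)
    by (simp add: adm_1 del: snth.simps)
  ultimately show "n_word !! nshift 2 m = L0" "n_word !! (nshift 3 m + 1) = L1"
    "n_word !! (nshift 4 m + 2) = L2"
    by metis+
qed

lemma index_cases:
  obtains (0) m where "k = nshift 2 m" | (1) m where "k = nshift 3 m + 1"
    | (2) m where "k = nshift 4 m + 2"
proof -
  obtain u where u: "adm u"
    and "replicate 2 0 @ narayana_rep k = u @ [0, 0] \<or>
      replicate 2 0 @ narayana_rep k = u @ [0, 0, Suc 0] \<or>
      replicate 2 0 @ narayana_rep k = u @ [0, 0, Suc 0, 0]"
    using adm_ending[OF narayana_rep_adm] by blast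
  then have "k = narayana_val (u @ [0, 0]) \<or> k = narayana_val (u @ [0, 0, Suc 0]) \<or>
      k = narayana_val (u @ [0, 0, Suc 0, 0])"
    by (metis narayana_val_rep narayana_val_zeros_append)
  moreover have "narayana_val (u @ [0, 0, Suc 0]) = nshift 3 (narayana_val u) + 1"
    using narayana_val_snoc[of "u @ [0, 0]" 1] u by (simp add: nshift_val numeral_3_eq_3)
  moreover have "narayana_val (u @ [0, 0, Suc 0, 0]) = nshift 4 (narayana_val u) + 2"
    using narayana_val_append_10[of "u @ [0, 0]"] u by (simp add: nshift_val eval_nat_numeral)
  moreover have "narayana_val (u @ [0, 0]) = nshift 2 (narayana_val u)"
    using u by (simp add: nshift_val numeral_2_eq_2)
  ultimately show ?thesis using that by metis
qed

text \<open>The three ranges cover all indices and carry distinct letters, so the implications of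
  \<open>n_word_nshift\<close> are equivalences.\<close>

lemma n_word_iff:
  "n_word !! k = L0 \<longleftrightarrow> (\<exists>m. k = nshift 2 m)"
  "n_word !! k = L1 \<longleftrightarrow> (\<exists>m. k = nshift 3 m + 1)"
  "n_word !! k = L2 \<longleftrightarrow> (\<exists>m. k = nshift 4 m + 2)"
proof -
  have "(n_word !! k = L0 \<and> (\<exists>m. k = nshift 2 m)) \<or>
      (n_word !! k = L1 \<and> (\<exists>m. k = nshift 3 m + 1)) \<or>
      (n_word !! k = L2 \<and> (\<exists>m. k = nshift 4 m + 2))"
    by (cases k rule: index_cases) (use n_word_nshift in blast)+
  moreover have "n_word !! k = L0" if "\<exists>m. k = nshift 2 m"
    using that n_word_nshift(1) by blast
  moreover have "n_word !! k = L1" if "\<exists>m. k = nshift 3 m + 1"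
    using that n_word_nshift(2) by blast
  moreover have "n_word !! k = L2" if "\<exists>m. k = nshift 4 m + 2"
    using that n_word_nshift(3) by blast
  ultimately show "n_word !! k = L0 \<longleftrightarrow> (\<exists>m. k = nshift 2 m)"
    "n_word !! k = L1 \<longleftrightarrow> (\<exists>m. k = nshift 3 m + 1)"
    "n_word !! k = L2 \<longleftrightarrow> (\<exists>m. k = nshift 4 m + 2)"
    by (metis letter.distinct)+
qed

lemma n_word_L0_iff: "n_word !! k \<in> {L0} \<longleftrightarrow> k \<in> range (nshift 2)"
  unfolding singleton_iff n_word_iff by blast

lemma n_word_L1_iff: "n_word !! k \<in> {L1} \<longleftrightarrow> k \<in> range (\<lambda>m. nshift 3 m + 1)"
  unfolding singleton_iff n_word_iff by blast

lemma n_word_L2_iff: "n_word !! k \<in> {L2} \<longleftrightarrow> k \<in> range (\<lambda>m. nshift 4 m + 2)"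
  unfolding singleton_iff n_word_iff by blast

text \<open>The endings 00 and 0010 are those whose last digit is 0. Conversely, appending 0 to the
  endings 00, 001, 0010 gives 000, 0010, 00100, with letters 0, 2, 0.\<close>

lemma n_word_L02_iff: "n_word !! k \<in> {L0, L2} \<longleftrightarrow> k \<in> range (nshift 1)"
proof
  assume "n_word !! k \<in> {L0, L2}"
  then show "k \<in> range (nshift 1)"
  proof (cases k rule: index_cases)
    case (0 m)
    then have "k = nshift 1 (nshift 1 m)" by (simp add: nshift_nshift numeral_2_eq_2)
    then show ?thesis by blast
  next
    case (1 m)
    with \<open>n_word !! k \<in> {L0, L2}\<close> n_word_nshift(2)[of m] show ?thesis by simp
  next
    case (2 m)
    then show ?thesis using nshift_Suc_shifted[of m] by (metis rangeI)
  qed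
next
  assume "k \<in> range (nshift 1)"
  then obtain i where k: "k = nshift 1 i" by blast
  show "n_word !! k \<in> {L0, L2}"
  proof (cases i rule: index_cases)
    case (0 m)
    then have "k = nshift 2 (nshift 1 m)" by (simp add: k nshift_nshift eval_nat_numeral)
    then show ?thesis using n_word_nshift by simp
  next
    case (1 m)
    then have "k = nshift 4 m + 2" using k nshift_Suc_shifted by simp
    then show ?thesis using n_word_nshift by simp
  next
    case (2 m)
    \<comment> \<open>The index \<open>i\<close> is itself a shift of \<open>nshift 3 m + 1\<close>,
      so \<open>k\<close> arises from that number by appending 00.\<close>
    then have "k = nshift 2 (nshift 3 m + 1)"
      using k nshift_Suc_shifted[of m] nshift_nshift[of 1 1 "nshift 3 m + 1"]
      by (simp add: numeral_2_eq_2)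
    then show ?thesis using n_word_nshift by simp
  qed
qed

subsection \<open>Positions\<close>

lemma enumerate_range_strict_mono:
  fixes f :: "nat \<Rightarrow> nat"
  assumes "strict_mono f"
  shows "enumerate (range f) n = f n"
proof (induction n)
  case 0
  show ?case
    unfolding enumerate_0
    by (rule Least_equality) (auto simp: strict_mono_less_eq[OF assms])
next
  case (Suc n)
  have "infinite (range f)"
    using assms by (simp add: range_inj_infinite strict_mono_imp_inj_on)
  then show ?case
    by (subst enumerate_Suc'') (auto simp: Suc strict_mono_less[OF assms]
        strict_mono_less_eq[OF assms] intro!: Least_equality)
qed

text \<open>The final 1 converts stream indices to positions; \<open>j - 1\<close> appears because
  \<open>enumerate\<close> counts from 0.\<close>

lemma pos_eq:
  assumes "strict_mono f" "\<And>k. n_word !! k \<in> A \<longleftrightarrow> k \<in> range f"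
  shows "pos A j = f (j - 1) + 1"
proof -
  have "{k. 1 \<le> k \<and> nprime k \<in> A} = range (\<lambda>m. f m + 1)"
  proof (intro set_eqI)
    fix k
    show "k \<in> {k. 1 \<le> k \<and> nprime k \<in> A} \<longleftrightarrow> k \<in> range (\<lambda>m. f m + 1)"
      using assms(2)[of "k - 1"] by (cases k) (auto simp: nprime_def)
  qed
  moreover have "strict_mono (\<lambda>m. f m + 1)"
    using assms(1) by (simp add: strict_mono_def)
  ultimately show ?thesis
    unfolding pos_def using enumerate_range_strict_mono by metis
qed

theorem theorem19:
  fixes j :: nat
  assumes "j \<ge> 1"
  shows "p02 j = narayana_val (narayana_rep (j - 1) @ [0]) + 1 \<and>
         p0 j = narayana_val (narayana_rep (j - 1) @ [0, 0]) + 1 \<and>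
         p1 j = narayana_val (narayana_rep (j - 1) @ [0, 0, 0]) + 2 \<and>
         p1 j = p0 j + j \<and>
         p2 j = narayana_val (narayana_rep (j - 1) @ [0, 0, 0, 0]) + 3 \<and>
         p2 j = p1 j + p02 j"
proof -
  let ?w = "narayana_rep (j - 1)"
  have mono: "strict_mono (\<lambda>m. nshift c m + d)" for c d
    using strict_mono_nshift[of c] by (simp add: strict_mono_def)
  have p02: "p02 j = narayana_val (?w @ [0]) + 1"
    using pos_eq[OF strict_mono_nshift n_word_L02_iff] by (simp add: nshift_def)
  have p0: "p0 j = narayana_val (?w @ [0, 0]) + 1"
    using pos_eq[OF strict_mono_nshift n_word_L0_iff] by (simp add: nshift_def numeral_2_eq_2)
  have p1: "p1 j = narayana_val (?w @ [0, 0, 0]) + 2"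
    using pos_eq[OF mono n_word_L1_iff] by (simp add: nshift_def numeral_3_eq_3)
  have p2: "p2 j = narayana_val (?w @ [0, 0, 0, 0]) + 3"
    using pos_eq[OF mono n_word_L2_iff] by (simp add: nshift_def eval_nat_numeral)
  \<comment> \<open>The recurrence contributes the value of \<open>?w\<close>, which is
    \<open>j - 1\<close>, and the offsets 2 and 1 differ by one; \<open>j \<ge> 1\<close> makes the
    sum \<open>j\<close>.\<close>
  have "p1 j = p0 j + j"
    using assms p0 p1 narayana_val_append_000[of ?w] by (simp add: narayana_val_rep)
  \<comment> \<open>Here the recurrence contributes the value of \<open>?w @ [0]\<close>, and the
    offsets satisfy 3 = 2 + 1.\<close>
  moreover have "p2 j = p1 j + p02 j"
    using p02 p1 p2 narayana_val_append_000[of "?w @ [0]"] by simp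
  ultimately show ?thesis using p02 p0 p1 p2 by blast
qed

end
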